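(* Let $f:\mathbb{R}^d\to\mathbb{R}$ be convex with $\mathcal{X}^*=\operatorname{argmin}_{x\in\mathbb{R}^d}f(x)\neq\emptyset$ and $f^*=\min_{x\in\mathbb{R}^d} f(x)$. Let $T\ge 0$ be an integer, $c>0$, $x^0\in\mathbb{R}^d$, and let the iterates be generated by the subgradient method $x^{k+1}=x^k-\alpha_k g(x^k)$ with $g(x^k)\in\partial f(x^k)$ and step sizes $$\alpha_k=\frac{\beta_k}{\|g(x^k)\|},\qquad \beta_k=\frac{c}{\sqrt{T+1}},\qquad k=0,1,\ldots,T.$$ Let $\tilde x^T=\frac{1}{T+1}\sum_{k=0}^T x^k$ and fix any $x^*\in\mathcal{X}^*$. Then the trajectory $\{x^k\}_{k=0}^T$ lies in the ball $\mathcal{A}:=\{x\in\mathbb{R}^d:\|x-x^*\|^2\le\|x^0-x^*\|^2+c^2\}$. Consequently, for any bounded open convex set $\mathcal{A}'$ that contains $\mathcal{A}$, $$f(\tilde x^T)-f^*\le\frac{L_{\mathcal{A}'}\left(\|x^0-x^*\|^2/c+c\right)}{2\sqrt{T+1}},$$ where $L_{\mathcal{A}'}>0$ is the Lipschitz constant of $f$ on $\mathcal{A}'$.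
   Context: $\|\cdot\|$ is the Euclidean norm. For convex $f$, $\partial f(x)=\{g\in\mathbb{R}^d: f(y)\ge f(x)+\langle g,y-x\rangle\ \forall y\in\mathbb{R}^d\}$; $g(x^k)$ denotes an arbitrarily chosen element of $\partial f(x^k)$. If $g(x^k)=0$, then $x^{k+1}=x^k$ regardless of the value assigned to $\alpha_k$. $f$ is not assumed globally Lipschitz; a finite-valued convex function is automatically Lipschitz on bounded sets, so a constant $L_{\mathcal{A}'}>0$ with $|f(x)-f(y)|\le L_{\mathcal{A}'}\|x-y\|$ for all $x,y\in\mathcal{A}'$ exists. *)

theory Defs
  imports "HOL-Analysis.Analysis"
begin

definition subdifferential :: "('a::real_inner \<Rightarrow> real) \<Rightarrow> 'a \<Rightarrow> 'a set" where
  "subdifferential f x = {g. \<forall>y. f y \<ge> f x + g \<bullet> (y - x)}"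

definition argmin_set :: "('a \<Rightarrow> real) \<Rightarrow> 'a set" where
  "argmin_set f = {x. is_arg_min f (\<lambda>_. True) x}"

(* The least element of the range. It is a genuine minimum only when argmin_set f is nonempty. *)
definition min_value :: "('a \<Rightarrow> real) \<Rightarrow> real" where
  "min_value f = (LEAST v. v \<in> range f)"

end

theory Submission
  imports Defs
begin

text \<open>
  Normalised steps have length \<open>\<beta>\<close>, so expanding the square gives
  \<open>\<parallel>x (k+1) - x*\<parallel>\<^sup>2 \<le> \<parallel>x k - x*\<parallel>\<^sup>2 - 2 \<beta> r k + \<beta>\<^sup>2\<close> with
  \<open>r k = \<langle>g k, x k - x*\<rangle> / \<parallel>g k\<parallel> \<ge> 0\<close>. Dropping \<open>r k\<close> bounds the trajectory by
  \<open>(T + 1) \<beta>\<^sup>2 = c\<^sup>2\<close>. Every iterate is therefore interior to \<open>A'\<close>, which forces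
  \<open>\<parallel>g k\<parallel> \<le> L\<close> and hence \<open>f (x k) - f* \<le> L r k\<close>; telescoping and Jensen's inequality
  finish the estimate.
\<close>

text \<open>By compactness \<open>f\<close> is bounded by some \<open>M\<close> on a ball one unit
  larger than a ball around \<open>S\<close>. The extra unit leaves room to prolong any segment with
  ends in \<open>S\<close>, and convexity passes the bound \<open>2 * M\<close> on the increase over
  the longer segment down to the slope of the shorter one.\<close>

lemma convex_on_bounded_imp_lipschitz:
  fixes f :: "'a::euclidean_space \<Rightarrow> real"
  assumes cvx: "convex_on UNIV f" and "bounded S"
  obtains L where "L > 0" "L-lipschitz_on S f"
proof -
  obtain R where R: "\<And>x. x \<in> S \<Longrightarrow> norm x \<le> R"
    using \<open>bounded S\<close> by (auto simp: bounded_iff)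
  have "continuous_on (cball 0 (R + 1)) f"
    using convex_on_continuous[OF open_UNIV cvx] continuous_on_subset by blast
  then have "bounded (f ` cball 0 (R + 1))"
    by (intro compact_imp_bounded compact_continuous_image) auto
  then obtain M where "M > 0" and M: "\<And>x. norm x \<le> R + 1 \<Longrightarrow> \<bar>f x\<bar> \<le> M"
    by (auto simp: bounded_pos)
  have le: "f y - f x \<le> 2 * M * norm (y - x)" if "x \<in> S" "y \<in> S" for x y
  proof (cases "x = y")
    case False
    \<comment> \<open>Extend the segment from \<open>x\<close> through \<open>y\<close> by unit length and interpolate.\<close>
    define n where "n = norm (y - x)"
    define z where "z = y + (1 / n) *\<^sub>R (y - x)"
    \<comment> \<open>The point \<open>z\<close> lies at distance \<open>n + 1\<close> from
      \<open>x\<close>, so this weight makes \<open>y\<close> the convex combination of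
      \<open>x\<close> and \<open>z\<close>. The bound \<open>t \<le> n\<close> later turns the
      weight into the distance.\<close>
    define t where "t = n / (n + 1)"
    have "n > 0" using False by (simp add: n_def)
    then have t: "0 \<le> t" "t \<le> 1" "t \<le> n" by (auto simp: t_def field_simps)
    have "t + t / n = n / (n + 1) + 1 / (n + 1)" using \<open>n > 0\<close> by (simp add: t_def)
    also have "\<dots> = 1" using \<open>n > 0\<close> by (simp flip: add_divide_distrib)
    finally have "t + t / n = 1" .
    have "(1 - t) *\<^sub>R x + t *\<^sub>R z = (1 - t - t / n) *\<^sub>R x + (t + t / n) *\<^sub>R y"
      by (simp add: z_def algebra_simps)
    then have y: "(1 - t) *\<^sub>R x + t *\<^sub>R z = y"
      using \<open>t + t / n = 1\<close> by (simp add: algebra_simps)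
    have "norm z \<le> norm y + norm ((1 / n) *\<^sub>R (y - x))"
      unfolding z_def by (rule norm_triangle_ineq)
    also have "norm ((1 / n) *\<^sub>R (y - x)) = 1"
      using \<open>n > 0\<close> by (simp add: n_def)
    finally have "norm z \<le> R + 1" using R[OF \<open>y \<in> S\<close>] by linarith
    then have "\<bar>f z\<bar> \<le> M" "\<bar>f x\<bar> \<le> M" using M R[OF \<open>x \<in> S\<close>] by auto
    then have fzx: "f z - f x \<le> 2 * M" by linarith
    have "f y \<le> (1 - t) * f x + t * f z"
      using convex_onD[OF cvx t(1,2), of x z] by (simp add: y)
    then have "f y - f x \<le> t * (f z - f x)" by (simp add: algebra_simps)
    also have "\<dots> \<le> t * (2 * M)" using fzx t by (intro mult_left_mono) auto
    also have "\<dots> \<le> n * (2 * M)" using t \<open>M > 0\<close> by (intro mult_right_mono) auto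
    finally show ?thesis by (simp add: n_def mult_ac)
  qed simp
  have "(2 * M)-lipschitz_on S f"
  proof (rule lipschitz_onI)
    fix x y assume "x \<in> S" "y \<in> S"
    then show "dist (f x) (f y) \<le> 2 * M * dist x y"
      using le[of x y] le[of y x] by (auto simp: dist_real_def dist_norm norm_minus_commute)
  qed (use \<open>M > 0\<close> in simp)
  with \<open>M > 0\<close> show ?thesis by (intro that[of "2 * M"]) auto
qed

text \<open>A move of length \<open>e\<close> in the direction of \<open>g\<close> raises
  \<open>f\<close> by at least \<open>e * norm g\<close>, while the Lipschitz condition allows at
  most \<open>L * e\<close>. Openness of \<open>S\<close> provides the room for this move.\<close>

lemma norm_subgradient_le_lipschitz:
  assumes lip: "L-lipschitz_on S f" and "open S" "x \<in> S"
    and g: "g \<in> subdifferential f x"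
  shows "norm g \<le> L"
proof (cases "g = 0")
  case True
  then show ?thesis using lipschitz_on_nonneg[OF lip] by simp
next
  case False
  obtain e where "e > 0" and e: "cball x e \<subseteq> S"
    using \<open>open S\<close> \<open>x \<in> S\<close> open_contains_cball by blast
  define y where "y = x + (e / norm g) *\<^sub>R g"
  have dist: "dist y x = e" using False \<open>e > 0\<close> by (simp add: y_def dist_norm)
  then have "y \<in> S" using e by (auto simp: dist_commute)
  have "g \<bullet> (y - x) = e * norm g"
    using False by (simp add: y_def power2_norm_eq_inner[symmetric] power2_eq_square)
  moreover have "f x + g \<bullet> (y - x) \<le> f y" using g by (simp add: subdifferential_def)
  ultimately have "e * norm g \<le> f y - f x" by linarith
  also have "\<dots> \<le> dist (f y) (f x)" by (simp add: dist_real_def)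
  also have "\<dots> \<le> L * e" using lipschitz_onD[OF lip \<open>y \<in> S\<close> \<open>x \<in> S\<close>] dist by simp
  finally show ?thesis using \<open>e > 0\<close> by (simp add: mult.commute)
qed

lemma argmin_set_le: "z \<in> argmin_set f \<Longrightarrow> f z \<le> (f y :: real)"
  by (auto simp: argmin_set_def is_arg_min_linorder)

lemma min_value_eq: "z \<in> argmin_set f \<Longrightarrow> min_value f = f z"
  unfolding min_value_def by (rule Least_equality) (auto intro: argmin_set_le)

lemma norm_normalised_step:
  fixes x g z :: "'a::real_inner"
  assumes "g \<noteq> 0"
  shows "(norm (x - (\<beta> / norm g) *\<^sub>R g - z))\<^sup>2 =
    (norm (x - z))\<^sup>2 - 2 * \<beta> * (g \<bullet> (x - z) / norm g) + \<beta>\<^sup>2"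
proof -
  have "x - (\<beta> / norm g) *\<^sub>R g - z = (x - z) - (\<beta> / norm g) *\<^sub>R g" by simp
  then have "(norm (x - (\<beta> / norm g) *\<^sub>R g - z))\<^sup>2 =
      (norm (x - z))\<^sup>2 - 2 * ((x - z) \<bullet> ((\<beta> / norm g) *\<^sub>R g)) + (norm ((\<beta> / norm g) *\<^sub>R g))\<^sup>2"
    by (simp only: power2_norm_eq_inner inner_diff inner_commute) (simp add: inner_commute)
  then show ?thesis using assms by (simp add: inner_commute)
qed

text \<open>Where \<open>g k = 0\<close>, the value of \<open>\<alpha> k\<close> is left free, since
  the iterate then stays put. The estimate ranges over all Lipschitz constants of \<open>f\<close>
  on \<open>A'\<close>; the separate existence clause keeps it from being vacuous.\<close>

theorem theorem1:
  fixes f :: "real ^ 'd \<Rightarrow> real"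
    and T :: nat
    and c :: real
    and x g :: "nat \<Rightarrow> real ^ 'd"
    and \<alpha> \<beta> :: "nat \<Rightarrow> real"
    and xstar xavg :: "real ^ 'd"
    and A :: "(real ^ 'd) set"
  assumes "convex_on UNIV f"
    and "argmin_set f \<noteq> {}"
    and "c > 0"
    and "\<And>k. k \<le> T \<Longrightarrow> g k \<in> subdifferential f (x k)"
    and "\<And>k. k \<le> T \<Longrightarrow> \<beta> k = c / sqrt (real T + 1)"
    and "\<And>k. k \<le> T \<Longrightarrow> g k \<noteq> 0 \<Longrightarrow> \<alpha> k = \<beta> k / norm (g k)"
    and "\<And>k. k \<le> T \<Longrightarrow> x (Suc k) = x k - \<alpha> k *\<^sub>R g k"
    and "xavg = (1 / (real T + 1)) *\<^sub>R (\<Sum>k=0..T. x k)"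
    and "xstar \<in> argmin_set f"
    and "A = {y. (norm (y - xstar))\<^sup>2 \<le> (norm (x 0 - xstar))\<^sup>2 + c\<^sup>2}"
  shows "(\<forall>k\<le>T. x k \<in> A) \<and>
    (\<forall>A'. bounded A' \<and> open A' \<and> convex A' \<and> A \<subseteq> A' \<longrightarrow>
      (\<exists>L>0. L-lipschitz_on A' f) \<and>
      (\<forall>L>0. L-lipschitz_on A' f \<longrightarrow>
        f xavg - min_value f \<le> L * ((norm (x 0 - xstar))\<^sup>2 / c + c) / (2 * sqrt (real T + 1))))"
proof -
  define s where "s = sqrt (real T + 1)"
  define b where "b = c / s"
  define D where "D k = (norm (x k - xstar))\<^sup>2" for k
  have s: "s > 0" "s\<^sup>2 = real T + 1" by (auto simp: s_def)
  have b: "b > 0" "(real T + 1) * b\<^sup>2 = c\<^sup>2"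
    using s \<open>c > 0\<close> by (auto simp: b_def power_divide)
  \<comment> \<open>The subgradient inequality at \<open>x k\<close>, tested at the point
    \<open>xstar\<close>.\<close>
  have gap: "f (x k) - f xstar \<le> g k \<bullet> (x k - xstar)" if "k \<le> T" for k
    using assms(4)[OF that]
    by (auto simp: subdifferential_def inner_diff_right algebra_simps dest: spec[of _ xstar])
  have step: "D (Suc k) = D k - 2 * b * (g k \<bullet> (x k - xstar) / norm (g k)) + b\<^sup>2"
    if "k \<le> T" "g k \<noteq> 0" for k
  proof -
    have "\<alpha> k = b / norm (g k)" using that assms(5,6) by (simp add: b_def s_def)
    then show ?thesis
      using norm_normalised_step[OF that(2)] that(1) assms(7) by (simp add: D_def)
  qed
  have stay: "D (Suc k) = D k" if "k \<le> T" "g k = 0" for k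
    using that assms(7) by (simp add: D_def)
  have D_Suc: "D (Suc k) \<le> D k + b\<^sup>2" if "k \<le> T" for k
  proof (cases "g k = 0")
    case False
    have "0 \<le> g k \<bullet> (x k - xstar)"
      using gap[OF that] argmin_set_le[OF assms(9), of "x k"] by linarith
    then have "0 \<le> 2 * b * (g k \<bullet> (x k - xstar) / norm (g k))" using b by simp
    then show ?thesis using step[OF that False] by linarith
  qed (simp add: stay that)
  have D_le: "D k \<le> D 0 + real k * b\<^sup>2" if "k \<le> T" for k
    using that
  proof (induction k)
    case (Suc k)
    then show ?case using D_Suc[of k] by (simp add: algebra_simps)
  qed simp
  have in_A: "x k \<in> A" if "k \<le> T" for k
  proof -
    \<comment> \<open>Reaching \<open>x k\<close> takes \<open>k \<le> T\<close> steps, each adding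
      at most \<open>b\<^sup>2\<close>; even \<open>T + 1\<close> steps would add only
      \<open>c\<^sup>2\<close>.\<close>
    have "real k * b\<^sup>2 \<le> (real T + 1) * b\<^sup>2" using that by (intro mult_right_mono) auto
    then show ?thesis using D_le[OF that] b(2) by (simp add: assms(10) D_def)
  qed
  have bound: "f xavg - min_value f \<le> L * (D 0 / c + c) / (2 * s)"
    if "open A'" "A \<subseteq> A'" "L > 0" and lip: "L-lipschitz_on A' f" for A' L
  proof -
    \<comment> \<open>Stated through differences of \<open>D\<close>, the bound telescopes and also
      covers a vanishing subgradient: then \<open>x k\<close> is a minimiser, \<open>D\<close> is
      unchanged, and the right side is \<open>L * b\<^sup>2\<close>.\<close>
    have term_le: "2 * b * (f (x k) - f xstar) \<le> L * (D k - D (Suc k) + b\<^sup>2)" if "k \<le> T" for k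
    proof (cases "g k = 0")
      case True
      then have "f (x k) - f xstar \<le> 0" using gap[OF that] by simp
      then have "2 * b * (f (x k) - f xstar) \<le> 0" using b by (simp add: mult_nonneg_nonpos)
      also have "0 \<le> L * b\<^sup>2" using \<open>L > 0\<close> by simp
      finally show ?thesis using stay[OF that True] by simp
    next
      case False
      define r where "r = g k \<bullet> (x k - xstar) / norm (g k)"
      have "0 \<le> r"
        using gap[OF that] argmin_set_le[OF assms(9), of "x k"] by (simp add: r_def)
      have "norm (g k) \<le> L"
        using norm_subgradient_le_lipschitz[OF lip \<open>open A'\<close> _ assms(4)[OF that]]
          in_A[OF that] \<open>A \<subseteq> A'\<close> by blast
      have "f (x k) - f xstar \<le> norm (g k) * r" using gap[OF that] False by (simp add: r_def)
      also have "\<dots> \<le> L * r"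
        using \<open>0 \<le> r\<close> \<open>norm (g k) \<le> L\<close> by (intro mult_right_mono)
      finally have "2 * b * (f (x k) - f xstar) \<le> 2 * b * (L * r)"
        using b by (intro mult_left_mono) auto
      also have "\<dots> = L * (D k - D (Suc k) + b\<^sup>2)"
        using step[OF that False] by (simp add: r_def)
      finally show ?thesis .
    qed
    have "xavg = (\<Sum>k=0..T. (1 / (real T + 1)) *\<^sub>R x k)"
      by (simp add: assms(8) scaleR_sum_right)
    \<comment> \<open>Jensen's inequality with equal weights.\<close>
    then have "f xavg \<le> (\<Sum>k=0..T. (1 / (real T + 1)) * f (x k))"
      using convex_on_sum[OF _ _ assms(1), of "{0..T}" "\<lambda>_. 1 / (real T + 1)" x] by simp
    also have "\<dots> = (\<Sum>k=0..T. f (x k)) / (real T + 1)"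
      by (simp add: sum_divide_distrib)
    finally have "s\<^sup>2 * f xavg \<le> (\<Sum>k=0..T. f (x k))"
      unfolding s(2) by (simp add: field_simps)
    then have "s\<^sup>2 * (f xavg - f xstar) \<le> (\<Sum>k=0..T. f (x k) - f xstar)"
      by (simp add: sum_subtractf s(2) algebra_simps)
    then have "2 * b * (s\<^sup>2 * (f xavg - f xstar)) \<le> 2 * b * (\<Sum>k=0..T. f (x k) - f xstar)"
      using b by (intro mult_left_mono) auto
    also have "\<dots> = (\<Sum>k=0..T. 2 * b * (f (x k) - f xstar))"
      by (simp add: sum_distrib_left)
    also have "\<dots> \<le> (\<Sum>k=0..T. L * (D k - D (Suc k) + b\<^sup>2))"
      by (intro sum_mono term_le) simp
    also have "\<dots> = L * ((\<Sum>k=0..T. D k - D (Suc k)) + (real T + 1) * b\<^sup>2)"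
      by (simp only: sum_distrib_left[symmetric] sum.distrib) (simp add: add.commute)
    \<comment> \<open>The sum ends at the distance of the extra iterate \<open>x (Suc T)\<close>,
      which is then dropped because a square is nonnegative.\<close>
    also have "\<dots> = L * (D 0 - D (Suc T) + c\<^sup>2)"
      unfolding atLeast0AtMost sum_telescope b(2) by simp
    also have "\<dots> \<le> L * (D 0 + c\<^sup>2)"
      using \<open>L > 0\<close> by (intro mult_left_mono) (auto simp: D_def)
    \<comment> \<open>Here \<open>b * s\<^sup>2 = c * s\<close>; dividing by
      \<open>2 * c * s\<close> then yields the claimed form.\<close>
    finally have "2 * c * s * (f xavg - f xstar) \<le> L * (D 0 + c\<^sup>2)"
      using s(1) by (simp add: b_def power2_eq_square)
    then show ?thesis
      using s(1) \<open>c > 0\<close> min_value_eq[OF assms(9)] by (simp add: field_simps power2_eq_square)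
  qed
  have "\<exists>L>0. L-lipschitz_on A' f" if "bounded A'" for A'
    using convex_on_bounded_imp_lipschitz[OF assms(1) that] by metis
  then show ?thesis
    using in_A bound[unfolded D_def s_def] by (intro conjI allI impI) auto
qed

end
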